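(* Let $F_j\in C^1(\Omega)$, $j=1,\dots,l$, and let $x^n\to x^0$ with $x^n,x^0\in\Omega$. Denote by $\widetilde T_n$, respectively $\widetilde T_0$, the generalized solutions contained in the bounded domain $\Omega$ corresponding to the initial conditions $x^n$, respectively $x^0$ (i.e. the generalized solution in $x^n$ of the system $F_j(x)=F_j(x^n)$, $j=1,\dots,l$, respectively in $x^0$ of the system $F_j(x)=F_j(x^0)$, $j=1,\dots,l$). Then $$\limsup_{n\to\infty}\widetilde T_n\subset\widetilde T_0 .$$
   Context: Setting: $1\le l\le d-1$ are integers, $\Omega\subset\mathbb{R}^d$ is a bounded domain, $F_1,\dots,F_l:\Omega\to\mathbb{R}$; $J(x)$ denotes the Jacobian matrix of $(F_1,\dots,F_l)$ at $x\in\Omega$. It is a standing assumption that the points $p$ under consideration ($p=x^0$ and $p=x^n$) are limits of sequences $\{p^m\}\subset\Omega$ with $$p^m\to p,\qquad \operatorname{rank}J(p^m)=l\ \ \forall m.\qquad( * )$$ Local solution manifolds: to each $z\in\Omega$ with $\operatorname{rank}J(z)=l$ is associated the local solution manifold $S(z)$ of the system $F_j(x)-F_j(z)=0$, $j=1,\dots,l$, around $z$, provided by the implicit function theorem (or the equivalent local ODE construction); it is a connected $(d-l)$-dimensional manifold with $z\in S(z)\subset\{x\in\Omega: F_j(x)=F_j(z),\ j=1,\dots,l,\ \operatorname{rank}J(x)=l\}$. The assignment $z\mapsto S(z)$ is fixed. Generalized solution in $p$: for a sequence satisfying $( * )$ let $T_m$ be the closure in $\overline\Omega$ of $S(p^m)$,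 a compact connected set. On a subsequence (denoted by $\alpha$) one has $T_m\to T_\alpha$ in the Hausdorff–Pompeiu metric, with $T_\alpha$ compact and connected. The generalized solution in $p$ is $\bigcup_\alpha T_\alpha$, the union being taken over all sequences satisfying $( * )$ and all their subsequences along which $T_m$ converges. $\limsup_{n\to\infty}\widetilde T_n$ is the set of all limits of convergent sequences $\widehat x_{n_k}\in\widetilde T_{n_k}$ with $n_k\to\infty$. *)

theory Defs
  imports "HOL-Analysis.Analysis"
begin

(* Only meaningful for open U: the derivative is taken in the full space, and continuity
   of f' is with respect to the operator norm. *)
definition C1_on :: "'a::real_normed_vector set \<Rightarrow> ('a \<Rightarrow> 'b::real_normed_vector) \<Rightarrow> bool" where
  "C1_on U f \<longleftrightarrow>
     (\<exists>f' :: 'a \<Rightarrow> 'a \<Rightarrow>\<^sub>L 'b. (\<forall>x\<in>U. (f has_derivative blinfun_apply (f' x)) (at x)) \<and> continuous_on U f')"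

(* Embedded C^1 submanifold without boundary: near each of its points, M is straightened
   to a piece of a k-dimensional linear subspace by a C^1 diffeomorphism of open sets. *)
definition C1_submanifold :: "nat \<Rightarrow> 'a::euclidean_space set \<Rightarrow> bool" where
  "C1_submanifold k M \<longleftrightarrow>
     (\<forall>y\<in>M. \<exists>U V \<phi> \<psi> L. open U \<and> y \<in> U \<and> open V \<and> homeomorphism U V \<phi> \<psi> \<and>
        C1_on U \<phi> \<and> C1_on V \<psi> \<and>
        subspace (L :: 'a set) \<and> dim L = k \<and> \<phi> ` (M \<inter> U) = L \<inter> V)"

(* The index type 'l stands for {1..l}, so l = CARD('l); the ambient space is real^'d, so
   d = CARD('d). The functions are total, but only their values on the open set \<Omega> matter. *)
definition regular_points ::
    "(real ^ 'd) set \<Rightarrow> ('l::finite \<Rightarrow> real ^ 'd \<Rightarrow> real) \<Rightarrow> (real ^ 'd) set" where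
  "regular_points \<Omega> F = {z\<in>\<Omega>. rank (jacobian (\<lambda>y. (\<chi> j. F j y) :: real ^ 'l) (at z)) = CARD('l)}"

definition local_solution_manifolds ::
    "(real ^ 'd) set \<Rightarrow> ('l::finite \<Rightarrow> real ^ 'd \<Rightarrow> real) \<Rightarrow> (real ^ 'd \<Rightarrow> (real ^ 'd) set) \<Rightarrow> bool" where
  "local_solution_manifolds \<Omega> F S \<longleftrightarrow>
     (\<forall>z\<in>regular_points \<Omega> F.
        z \<in> S z \<and>
        S z \<subseteq> {x \<in> regular_points \<Omega> F. \<forall>j. F j x = F j z} \<and>
        connected (S z) \<and>
        C1_submanifold (CARD('d) - CARD('l)) (S z))"

definition regular_sequence_to ::
    "(real ^ 'd) set \<Rightarrow> ('l::finite \<Rightarrow> real ^ 'd \<Rightarrow> real) \<Rightarrow> real ^ 'd \<Rightarrow> (nat \<Rightarrow> real ^ 'd) \<Rightarrow> bool" where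
  "regular_sequence_to \<Omega> F p q \<longleftrightarrow> (\<forall>m. q m \<in> regular_points \<Omega> F) \<and> q \<longlonglongrightarrow> p"

(* A metric on the nonempty compact sets; elsewhere the value carries no meaning. *)
definition hausdorff_pompeiu_dist :: "'a::metric_space set \<Rightarrow> 'a set \<Rightarrow> real" where
  "hausdorff_pompeiu_dist A B = max (SUP a\<in>A. infdist a B) (SUP b\<in>B. infdist b A)"

(* Union of all limits T of all convergent subsequences, for all regular sequences tending to p.
   S (q m) lies in \<Omega>, so its closure in the closure of \<Omega> is its closure in the whole space.
   Limits are taken in the space of nonempty compact sets, where they are unique; their
   connectedness is a consequence and is not demanded. *)
definition generalized_solution ::
    "(real ^ 'd) set \<Rightarrow> ('l::finite \<Rightarrow> real ^ 'd \<Rightarrow> real) \<Rightarrow> (real ^ 'd \<Rightarrow> (real ^ 'd) set) \<Rightarrow>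
     real ^ 'd \<Rightarrow> (real ^ 'd) set" where
  "generalized_solution \<Omega> F S p =
     \<Union> {T. \<exists>q \<alpha>. regular_sequence_to \<Omega> F p q \<and> strict_mono (\<alpha> :: nat \<Rightarrow> nat) \<and>
            compact T \<and> T \<noteq> {} \<and>
            (\<lambda>m. hausdorff_pompeiu_dist (closure (S (q (\<alpha> m)))) T) \<longlonglongrightarrow> 0}"

definition limsup_sets :: "(nat \<Rightarrow> 'a::topological_space set) \<Rightarrow> 'a set" where
  "limsup_sets T =
     {x. \<exists>(n :: nat \<Rightarrow> nat) y. filterlim n at_top sequentially \<and> (\<forall>k. y k \<in> T (n k)) \<and> y \<longlonglongrightarrow> x}"

end

theory Submission
  imports Defs "HOL-Complex_Analysis.Great_Picard"
begin

text \<open>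
  Choose \<open>y\<^sub>k \<in> T\<^sub>k\<close> tending to \<open>z\<close>, where \<open>T\<^sub>k\<close> is one of the sets making up the generalized
  solution in \<open>x (n k)\<close>. Diagonally, there is a regular point \<open>p\<^sub>k\<close> within \<open>1/(k+1)\<close> of
  \<open>x (n k)\<close> such that the closure of \<open>S p\<^sub>k\<close> is within \<open>1/(k+1)\<close> of \<open>T\<^sub>k\<close>. Then \<open>p\<^sub>k\<close> tends to
  \<open>x0\<close>, and by Blaschke's selection theorem a subsequence of these closures has a
  Hausdorff-Pompeiu limit, which must contain \<open>z\<close>.

  Blaschke's theorem follows from Arzela-Ascoli applied to the 1-Lipschitz functions
  \<open>\<lambda>x. infdist x (A n)\<close>: the Hausdorff-Pompeiu limit is the zero set of their uniform limit.
\<close>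

lemma infdist_lipschitz: "\<bar>infdist x A - infdist y A\<bar> \<le> dist x y"
  using infdist_triangle[of x A y] infdist_triangle[of y A x] by (simp add: dist_commute)

text \<open>A real supremum is informative only for a set bounded above. This bound makes both
  suprema in \<open>hausdorff_pompeiu_dist\<close> genuine, so that each one dominates its
  members.\<close>

lemma bdd_above_infdist_image:
  assumes "bounded B"
  shows "bdd_above ((\<lambda>b. infdist b A) ` B)"
proof (cases "B = {}")
  case False
  then obtain c where "c \<in> B" by blast
  obtain e where e: "\<And>b. b \<in> B \<Longrightarrow> dist c b \<le> e"
    using assms bounded_any_center[of B c] by auto
  have "infdist b A \<le> infdist c A + e" if "b \<in> B" for b
    using infdist_triangle[of b A c] e[OF that] by (simp add: dist_commute)
  then show ?thesis by (rule bdd_aboveI2)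
qed simp

lemma infdist_le_hausdorff_pompeiu_dist:
  assumes "bounded A" "bounded B"
  shows "a \<in> A \<Longrightarrow> infdist a B \<le> hausdorff_pompeiu_dist A B"
    and "b \<in> B \<Longrightarrow> infdist b A \<le> hausdorff_pompeiu_dist A B"
  unfolding hausdorff_pompeiu_dist_def
  using assms
  by (intro max.coboundedI1 max.coboundedI2 cSUP_upper bdd_above_infdist_image; simp)+

text \<open>A point of \<open>A\<close> is what forces the sign: its distance to \<open>B\<close> is
  nonnegative and lies below the first supremum, whereas the real supremum of an empty set has no
  specified value.\<close>

lemma hausdorff_pompeiu_dist_nonneg:
  assumes "bounded A" "bounded B" "A \<noteq> {}"
  shows "0 \<le> hausdorff_pompeiu_dist A B"
proof -
  obtain a where "a \<in> A" using assms(3) by blast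
  then show ?thesis
    using infdist_le_hausdorff_pompeiu_dist(1)[OF assms(1,2)] infdist_nonneg order_trans by blast
qed

lemma hausdorff_pompeiu_dist_le:
  assumes "A \<noteq> {}" "B \<noteq> {}"
    and "\<And>a. a \<in> A \<Longrightarrow> infdist a B \<le> e" "\<And>b. b \<in> B \<Longrightarrow> infdist b A \<le> e"
  shows "hausdorff_pompeiu_dist A B \<le> e"
  unfolding hausdorff_pompeiu_dist_def using assms by (auto intro!: cSUP_least)

theorem Blaschke_selection:
  fixes A :: "nat \<Rightarrow> 'a::euclidean_space set"
  assumes K: "compact K" and A: "\<And>n. compact (A n)" "\<And>n. A n \<noteq> {}" "\<And>n. A n \<subseteq> K"
  obtains T r where "compact T" "T \<noteq> {}" "T \<subseteq> K" "strict_mono (r :: nat \<Rightarrow> nat)"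
    "(\<lambda>n. hausdorff_pompeiu_dist (A (r n)) T) \<longlonglongrightarrow> 0"
proof -
  have "bounded K" using K by (rule compact_imp_bounded)
  then obtain M where M: "\<And>x y. x \<in> K \<Longrightarrow> y \<in> K \<Longrightarrow> dist x y \<le> M"
    unfolding bounded_two_points by blast
  have bound: "norm (infdist x (A n)) \<le> M" if "x \<in> K" for n x
  proof -
    obtain a where a: "a \<in> A n" using A(2) by blast
    then have "infdist x (A n) \<le> dist x a" by (rule infdist_le)
    also have "\<dots> \<le> M" using M that a A(3) by blast
    finally show ?thesis by (simp add: infdist_nonneg)
  qed
  have equicont: "\<exists>d>0. \<forall>n y. y \<in> K \<and> norm (x - y) < d \<longrightarrow> norm (infdist x (A n) - infdist y (A n)) < e"
    if "x \<in> K" "0 < e" for x e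
    using that by (auto intro!: exI[of _ e] order_le_less_trans[OF infdist_lipschitz] simp: dist_norm)
  obtain g r where g: "continuous_on K g" and r: "strict_mono (r :: nat \<Rightarrow> nat)"
    and conv: "\<And>e. 0 < e \<Longrightarrow> \<exists>N. \<forall>n x. n \<ge> N \<and> x \<in> K \<longrightarrow> norm (infdist x (A (r n)) - g x) < e"
    by (rule Arzela_Ascoli[of K "\<lambda>n x. infdist x (A n)", OF K bound equicont], assumption+) (rule that)
  have pointwise: "(\<lambda>n. infdist x (A (r n))) \<longlonglongrightarrow> g x" if "x \<in> K" for x
    by (rule LIMSEQ_I) (use conv that in blast)
  define T where "T = {x \<in> K. g x = 0}"
  have "closed T"
    unfolding T_def by (rule continuous_closed_preimage_constant[OF g compact_imp_closed[OF K]])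
  then have T: "compact T" "T \<subseteq> K"
    using K compact_Int_closed[of K T] by (auto simp: T_def Int_def)
  \<comment> \<open>This compares the limit function with the distance to \<open>T\<close>: it
    yields \<open>infdist x T \<le> g x\<close>, and also that \<open>T\<close> is nonempty. The
    witness is a cluster point \<open>l\<close> of points of \<open>A (r n)\<close> nearest to
    \<open>x\<close>.\<close>
  have nearest: "\<exists>a\<in>T. dist x a = g x" if x: "x \<in> K" for x
  proof -
    have "\<exists>a. a \<in> A (r n) \<and> infdist x (A (r n)) = dist x a" for n
      using infdist_attains_inf[OF compact_imp_closed[OF A(1)] A(2)] by blast
    then obtain a where a: "\<And>n. a n \<in> A (r n)" "\<And>n. infdist x (A (r n)) = dist x (a n)"
      by metis
    then obtain l s where l: "l \<in> K" and s: "strict_mono (s :: nat \<Rightarrow> nat)" "(a \<circ> s) \<longlonglongrightarrow> l"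
      using K A(3) unfolding compact_def by (metis subsetD)
    \<comment> \<open>Membership of \<open>l\<close> in \<open>T\<close> means
      \<open>g l = 0\<close>. The distance from \<open>l\<close> to \<open>A (r (s n))\<close> is at
      most the distance to its point \<open>a (s n)\<close>, which tends to 0.\<close>
    have "(\<lambda>n. dist l (a (s n))) \<longlonglongrightarrow> 0"
      using tendsto_dist[OF tendsto_const s(2), of l] by (simp add: o_def)
    then have "(\<lambda>n. infdist l (A (r (s n)))) \<longlonglongrightarrow> 0"
      by (rule Lim_null_comparison[rotated]) (simp add: infdist_nonneg infdist_le a(1))
    moreover have "(\<lambda>n. infdist l (A (r (s n)))) \<longlonglongrightarrow> g l"
      using LIMSEQ_subseq_LIMSEQ[OF pointwise[OF l] s(1)] by (simp add: o_def)
    ultimately have "l \<in> T" using l LIMSEQ_unique by (auto simp: T_def)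
    moreover have "dist x l = g x"
      using LIMSEQ_subseq_LIMSEQ[OF pointwise[OF x] s(1)] tendsto_dist[OF tendsto_const s(2), of x]
      by (intro LIMSEQ_unique[of "\<lambda>n. dist x (a (s n))"]) (simp_all add: o_def a(2))
    ultimately show ?thesis by blast
  qed
  then have "T \<noteq> {}" using A(2,3) by blast
  have "\<exists>N. \<forall>n\<ge>N. norm (hausdorff_pompeiu_dist (A (r n)) T - 0) < e" if e: "0 < e" for e
  proof -
    \<comment> \<open>Strict pointwise bounds survive in a supremum only as non-strict ones, hence
      \<open>e / 2\<close>.\<close>
    obtain N where N: "\<And>n x. n \<ge> N \<Longrightarrow> x \<in> K \<Longrightarrow> \<bar>infdist x (A (r n)) - g x\<bar> < e / 2"
      using conv[OF half_gt_zero[OF e]] unfolding real_norm_def by blast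
    have "norm (hausdorff_pompeiu_dist (A (r n)) T - 0) < e" if n: "n \<ge> N" for n
    proof -
      \<comment> \<open>On \<open>A (r n)\<close> the distance to \<open>A (r n)\<close> vanishes,
        so \<open>g\<close> is below \<open>e / 2\<close> there; on \<open>T\<close> it is
        \<open>g\<close> that vanishes. Uniform closeness thus controls both one-sided
        distances.\<close>
      have "hausdorff_pompeiu_dist (A (r n)) T \<le> e / 2"
      proof (rule hausdorff_pompeiu_dist_le)
        show "infdist a T \<le> e / 2" if "a \<in> A (r n)" for a
        proof -
          have "a \<in> K" using that A(3) by blast
          then obtain t where "t \<in> T" "dist a t = g a" using nearest by blast
          then have "infdist a T \<le> g a" using infdist_le by metis
          then show ?thesis using N[OF n \<open>a \<in> K\<close>] that by simp
        qed
        show "infdist b (A (r n)) \<le> e / 2" if "b \<in> T" for b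
          using N[OF n, of b] that by (simp add: T_def)
      qed (use A(2) \<open>T \<noteq> {}\<close> in auto)
      moreover have "0 \<le> hausdorff_pompeiu_dist (A (r n)) T"
        using A T by (intro hausdorff_pompeiu_dist_nonneg) (auto intro: compact_imp_bounded)
      ultimately show ?thesis using e by simp
    qed
    then show ?thesis by blast
  qed
  then have "(\<lambda>n. hausdorff_pompeiu_dist (A (r n)) T) \<longlonglongrightarrow> 0" by (intro LIMSEQ_I)
  then show ?thesis using that T \<open>T \<noteq> {}\<close> r by blast
qed

text \<open>Walk from \<open>z\<close> to \<open>y k\<close>, on to a nearest point of
  \<open>C k\<close>, and from there to \<open>T\<close>. All three lengths tend to 0, and
  \<open>T\<close> is closed.\<close>

lemma hausdorff_pompeiu_limit_mem:
  fixes C :: "nat \<Rightarrow> 'a::heine_borel set"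
  assumes "\<And>k. compact (C k)" "\<And>k. C k \<noteq> {}" and T: "compact T" "T \<noteq> {}"
    and lim: "(\<lambda>k. hausdorff_pompeiu_dist (C k) T) \<longlonglongrightarrow> 0"
    and y: "y \<longlonglongrightarrow> z" "(\<lambda>k. infdist (y k) (C k)) \<longlonglongrightarrow> 0"
  shows "z \<in> T"
proof -
  have "infdist z T \<le> dist z (y k) + infdist (y k) (C k) + hausdorff_pompeiu_dist (C k) T" for k
  proof -
    obtain c where c: "c \<in> C k" "infdist (y k) (C k) = dist (y k) c"
      using infdist_attains_inf[OF compact_imp_closed[OF assms(1)[of k]] assms(2)[of k]] by blast
    have "infdist z T \<le> infdist c T + dist z c" by (rule infdist_triangle)
    also have "infdist c T \<le> hausdorff_pompeiu_dist (C k) T"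
      using assms(1) T(1) c(1) by (intro infdist_le_hausdorff_pompeiu_dist) (auto intro: compact_imp_bounded)
    finally show ?thesis using c(2) dist_triangle[of z c "y k"] by simp
  qed
  moreover have "(\<lambda>k. dist z (y k) + infdist (y k) (C k) + hausdorff_pompeiu_dist (C k) T)
      \<longlonglongrightarrow> dist z z + 0 + 0"
    using y lim by (intro tendsto_intros)
  ultimately have "infdist z T \<le> 0" by (intro LIMSEQ_le_const) auto
  then show ?thesis
    using in_closed_iff_infdist_zero[OF compact_imp_closed[OF T(1)] T(2)] infdist_nonneg[of z T]
    by simp
qed

theorem proposition4:
  fixes \<Omega> :: "(real ^ 'd) set"
    and F :: "'l::finite \<Rightarrow> real ^ 'd \<Rightarrow> real"
    and S :: "real ^ 'd \<Rightarrow> (real ^ 'd) set"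
    and x :: "nat \<Rightarrow> real ^ 'd" and x0 :: "real ^ 'd"
  assumes "CARD('l) < CARD('d)"
    and "open \<Omega>" and "connected \<Omega>" and "\<Omega> \<noteq> {}" and "bounded \<Omega>"
    and "\<And>j. C1_on \<Omega> (F j)"
    and "local_solution_manifolds \<Omega> F S"
    and "\<And>n. x n \<in> \<Omega>" and "x0 \<in> \<Omega>" and "x \<longlonglongrightarrow> x0"
    and "\<And>n. \<exists>q. regular_sequence_to \<Omega> F (x n) q"
    and "\<exists>q. regular_sequence_to \<Omega> F x0 q"
  shows "limsup_sets (\<lambda>n. generalized_solution \<Omega> F S (x n)) \<subseteq> generalized_solution \<Omega> F S x0"
proof
  fix z assume "z \<in> limsup_sets (\<lambda>n. generalized_solution \<Omega> F S (x n))"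
  then obtain n y where n: "filterlim n at_top sequentially"
    and y: "\<And>k. y k \<in> generalized_solution \<Omega> F S (x (n k))" "y \<longlonglongrightarrow> z"
    unfolding limsup_sets_def by blast
  have manifold: "p \<in> S p" "S p \<subseteq> \<Omega>" if "p \<in> regular_points \<Omega> F" for p
    using assms(7) that by (auto simp: local_solution_manifolds_def regular_points_def)
  \<comment> \<open>Boundedness of \<Omega> enters here: all these closures lie in the single
    compact set \<open>closure \<Omega>\<close>, as the selection theorem requires.\<close>
  have compact: "compact (closure (S p))" "closure (S p) \<noteq> {}" "closure (S p) \<subseteq> closure \<Omega>"
    if "p \<in> regular_points \<Omega> F" for p
    using manifold[OF that] bounded_subset[OF \<open>bounded \<Omega>\<close>, of "S p"] closure_mono[of "S p" \<Omega>]
    by (simp_all, blast)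
  \<comment> \<open>Of the closeness to the limit set through \<open>y k\<close>, only the distance
    from \<open>y k\<close> itself is kept; that set is not mentioned again.\<close>
  have "\<exists>p. p \<in> regular_points \<Omega> F \<and> dist p (x (n k)) < inverse (Suc k) \<and>
      infdist (y k) (closure (S p)) < inverse (Suc k)" for k
  proof -
    obtain T q \<alpha> where q: "regular_sequence_to \<Omega> F (x (n k)) q" and \<alpha>: "strict_mono (\<alpha> :: nat \<Rightarrow> nat)"
      and T: "compact T" "y k \<in> T"
      and lim: "(\<lambda>m. hausdorff_pompeiu_dist (closure (S (q (\<alpha> m)))) T) \<longlonglongrightarrow> 0"
      using y(1)[of k] unfolding generalized_solution_def by blast
    have q': "\<And>m. q m \<in> regular_points \<Omega> F" "(\<lambda>m. q (\<alpha> m)) \<longlonglongrightarrow> x (n k)"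
      using q LIMSEQ_subseq_LIMSEQ[OF _ \<alpha>, of q] by (auto simp: regular_sequence_to_def o_def)
    have pos: "0 < inverse (real (Suc k))" by simp
    obtain m where m: "dist (q (\<alpha> m)) (x (n k)) < inverse (Suc k)"
        "hausdorff_pompeiu_dist (closure (S (q (\<alpha> m)))) T < inverse (Suc k)"
      using eventually_happens'[OF sequentially_bot
          eventually_conj[OF tendstoD[OF q'(2) pos] order_tendstoD(2)[OF lim pos]]] by blast
    have "infdist (y k) (closure (S (q (\<alpha> m)))) \<le> hausdorff_pompeiu_dist (closure (S (q (\<alpha> m)))) T"
      using T compact(1)[OF q'(1)]
      by (intro infdist_le_hausdorff_pompeiu_dist) (auto intro: compact_imp_bounded)
    then show ?thesis using m q'(1) by (intro exI[of _ "q (\<alpha> m)"]) simp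
  qed
  then obtain p where p: "\<And>k. p k \<in> regular_points \<Omega> F"
      "\<And>k. dist (p k) (x (n k)) < inverse (Suc k)"
      "\<And>k. infdist (y k) (closure (S (p k))) < inverse (Suc k)"
    by metis
  have "(\<lambda>k. p k - x (n k)) \<longlonglongrightarrow> 0"
    by (rule Lim_null_comparison[OF _ LIMSEQ_inverse_real_of_nat])
      (use p(2) in \<open>auto intro!: always_eventually less_imp_le simp flip: dist_norm\<close>)
  \<comment> \<open>The indices \<open>n k\<close> tend to infinity but may repeat or decrease, so
    this is a composition of limits rather than passage to a subsequence.\<close>
  moreover have "(\<lambda>k. x (n k)) \<longlonglongrightarrow> x0"
    using \<open>x \<longlonglongrightarrow> x0\<close> n by (rule filterlim_compose)
  ultimately have "p \<longlonglongrightarrow> x0" using tendsto_add by fastforce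
  \<comment> \<open>So \<open>p\<close> is admissible in the definition of the generalized solution
    in \<open>x0\<close>. With \<open>r\<close> below in the role of \<alpha>, the set
    \<open>T\<close> is one of those in the union.\<close>
  then have "regular_sequence_to \<Omega> F x0 p" using p(1) by (simp add: regular_sequence_to_def)
  moreover obtain T r where T: "compact T" "T \<noteq> {}" and r: "strict_mono (r :: nat \<Rightarrow> nat)"
    and lim: "(\<lambda>k. hausdorff_pompeiu_dist (closure (S (p (r k)))) T) \<longlonglongrightarrow> 0"
    by (rule Blaschke_selection[of "closure \<Omega>" "\<lambda>k. closure (S (p k))", OF _ compact[OF p(1)]])
      (use \<open>bounded \<Omega>\<close> in simp, rule that)
  moreover have "z \<in> T"
  proof (rule hausdorff_pompeiu_limit_mem[OF _ _ T lim])
    show "(y \<circ> r) \<longlonglongrightarrow> z" using y(2) r by (rule LIMSEQ_subseq_LIMSEQ)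
    have "(\<lambda>k. infdist (y k) (closure (S (p k)))) \<longlonglongrightarrow> 0"
      by (rule Lim_null_comparison[OF _ LIMSEQ_inverse_real_of_nat])
        (use p(3) in \<open>auto intro!: always_eventually less_imp_le simp: infdist_nonneg\<close>)
    from LIMSEQ_subseq_LIMSEQ[OF this r]
    show "(\<lambda>k. infdist ((y \<circ> r) k) (closure (S (p (r k))))) \<longlonglongrightarrow> 0" by (simp add: o_def)
  qed (use compact p(1) in auto)
  ultimately show "z \<in> generalized_solution \<Omega> F S x0"
    unfolding generalized_solution_def by blast
qed

end
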